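(* Let $n\ge1$ be an integer, $\beta_1,\dots,\beta_n>0$ and $B_1,\dots,B_n\ge0$ with $B_1^2+\dots+B_n^2\ne0$. Then for all $z>0$ $$E_{B_1,\beta_1;B_2,\beta_2;\dots;B_n,\beta_n}(z)\,E_{B_1,\beta_1+2;B_2,\beta_2;\dots;B_n,\beta_n}(z)-\frac{\beta_1}{\beta_1+1}\Big(E_{B_1,\beta_1+1;B_2,\beta_2;\dots;B_n,\beta_n}(z)\Big)^2\ge0.$$
   Context: The $2n$-parametric Mittag-Leffler function is defined, for $B_1^2+\dots+B_n^2\neq0$, by $$E_{B_1,\beta_1;\dots;B_n,\beta_n}(z)=\sum_{k=0}^\infty\frac{z^k}{\prod_{j=1}^n\Gamma(\beta_j+kB_j)}.$$ *)

theory Defs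
  imports "HOL-Analysis.Analysis"
begin

(* Parameters are indexed by {1..n}; values outside that range are irrelevant.
   Gamma is 0 at its poles, so with x / 0 = 0 a term having a pole in its
   denominator vanishes, which is the usual convention 1 / Gamma = 0 there. *)
definition mittag_leffler ::
    "nat \<Rightarrow> (nat \<Rightarrow> real) \<Rightarrow> (nat \<Rightarrow> 'a::Gamma) \<Rightarrow> 'a \<Rightarrow> 'a" where
  "mittag_leffler n B \<beta> z =
     (\<Sum>k. z ^ k / (\<Prod>j=1..n. Gamma (\<beta> j + of_nat k * of_real (B j))))"

end

theory Submission
  imports Defs
begin

text \<open>
  Put \<open>x\<^sub>k = \<beta>\<^sub>1 + k B\<^sub>1\<close> and let \<open>w\<^sub>k\<close> be the \<open>k\<close>-th term of the series with \<open>\<beta>\<^sub>1 + 1\<close> in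
  place of \<open>\<beta>\<^sub>1\<close>.  Since \<open>\<Gamma>(x + 1) = x \<Gamma>(x)\<close>, the three series in the inequality are
  \<open>\<Sum> w\<^sub>k x\<^sub>k\<close>, \<open>\<Sum> w\<^sub>k / (x\<^sub>k + 1)\<close> and \<open>\<Sum> w\<^sub>k\<close>.  The inequality is thus about a weighted
  mean \<open>m\<close> of the numbers \<open>x\<^sub>k \<ge> \<beta>\<^sub>1\<close>: by Jensen's inequality for the convex function
  \<open>x \<mapsto> 1 / (x + 1)\<close>, the mean of \<open>1 / (x\<^sub>k + 1)\<close> is at least \<open>1 / (m + 1)\<close>, and
  \<open>m / (m + 1) \<ge> \<beta>\<^sub>1 / (\<beta>\<^sub>1 + 1)\<close> because \<open>m \<ge> \<beta>\<^sub>1\<close>.  This is the lemma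
  \<open>weighted_mean_inequality\<close>.

  Convergence comes from the lemma \<open>Gamma_ge_exponential\<close>: the Gamma function outgrows every
  exponential function, so a single index with \<open>B\<^sub>j > 0\<close> makes the terms decay geometrically,
  while the remaining factors are bounded away from \<open>0\<close>.
\<close>

text \<open>
  In Euler's integral for \<open>\<Gamma>(x)\<close>, the part over \<open>[C, C + 1]\<close> alone is already of order
  \<open>C\<^sup>x\<close>: there \<open>t powr (x - 1) = t powr x / t \<ge> C powr x / (C + 1)\<close>.  With \<open>C = 1\<close> this says
  that \<open>\<Gamma>\<close> is bounded away from \<open>0\<close> on the positive half-line.
\<close>
lemma Gamma_ge_exponential:
  fixes C x :: real
  assumes C: "C > 0" and x: "x > 0"
  shows "Gamma x \<ge> exp (- (C + 1)) / (C + 1) * C powr x"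
proof -
  let ?f = "\<lambda>t. t powr (x - 1) / exp t"
  let ?c = "exp (- (C + 1)) / (C + 1) * C powr x"
  have G: "(?f has_integral Gamma x) {0..}"
    using Gamma_integral_real[OF x] .
  have "((\<lambda>_. ?c) has_integral ?c) {C..C+1}"
    using has_integral_const_real[of ?c C "C + 1"] by simp
  moreover have "?c \<le> ?f t" if t: "t \<in> {C..C+1}" for t
  proof -
    have "?c = C powr x / (C + 1) * exp (- (C + 1))"
      by simp
    also have "\<dots> \<le> t powr x / t * exp (- t)"
      using t C x by (intro mult_mono frac_le powr_mono2) auto
    also have "\<dots> = ?f t"
      using t C by (simp add: powr_diff exp_minus field_simps)
    finally show ?thesis .
  qed
  moreover have "((\<lambda>t. if t \<in> {C..C+1} then ?c else 0) has_integral ?c) {0..}"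
    using calculation(1) C by (subst has_integral_restrict) auto
  ultimately show ?thesis
    by (intro has_integral_le[OF _ G]) auto
qed

lemma mittag_leffler_summable:
  fixes \<beta> B :: "nat \<Rightarrow> real" and z :: real
  assumes \<beta>: "\<And>j. j \<in> {1..n} \<Longrightarrow> \<beta> j > 0"
    and B: "\<And>j. j \<in> {1..n} \<Longrightarrow> B j \<ge> 0"
    and i: "i \<in> {1..n}" "B i > 0"
    and z: "z > 0"
  shows "summable (\<lambda>k. z ^ k / (\<Prod>j=1..n. Gamma (\<beta> j + real k * B j)))"
proof -
  \<comment> \<open>The base \<open>C\<close> is chosen so that \<open>C powr (k * B i) = (2 * z) ^ k\<close>, which turns the
    comparison series into a geometric series of ratio \<open>1 / 2\<close>.\<close>
  define C where "C = (2 * z) powr (1 / B i)"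
  have C: "C > 0" using z by (simp add: C_def)
  define c where "c = exp (- (C + 1)) / (C + 1) * C powr \<beta> i"
  have c: "c > 0" using C by (simp add: c_def)
  define d :: real where "d = exp (- 2) / 2"
  have d: "d > 0" by (simp add: d_def)
  have arg: "\<beta> j + real k * B j > 0" if "j \<in> {1..n}" for j k
    using \<beta>[OF that] B[OF that] by (intro add_pos_nonneg) auto
  have low_i: "Gamma (\<beta> i + real k * B i) \<ge> c * (2 * z) ^ k" for k
  proof -
    have "C powr (\<beta> i + real k * B i) = C powr \<beta> i * (2 * z) powr real k"
      using i by (simp add: C_def powr_add powr_powr)
    also have "\<dots> = C powr \<beta> i * (2 * z) ^ k"
      using z by (simp add: powr_realpow)
    finally show ?thesis
      using Gamma_ge_exponential[OF C arg[OF i(1), of k]] by (simp add: c_def mult.assoc)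
  qed
  have low: "Gamma (\<beta> j + real k * B j) \<ge> d" if "j \<in> {1..n}" for j k
    using Gamma_ge_exponential[of 1, OF _ arg[OF that, of k]] by (simp add: d_def)
  have low_prod: "(\<Prod>j=1..n. Gamma (\<beta> j + real k * B j)) \<ge> c * (2 * z) ^ k * d ^ (n - 1)" for k
  proof -
    have "(\<Prod>j\<in>{1..n}-{i}. d) \<le> (\<Prod>j\<in>{1..n}-{i}. Gamma (\<beta> j + real k * B j))"
      using low d by (intro prod_mono) (auto intro: less_imp_le)
    moreover have "card ({1..n} - {i}) = n - 1"
      using i by simp
    ultimately have "d ^ (n - 1) \<le> (\<Prod>j\<in>{1..n}-{i}. Gamma (\<beta> j + real k * B j))"
      by simp
    then have "c * (2 * z) ^ k * d ^ (n - 1) \<le>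
        Gamma (\<beta> i + real k * B i) * (\<Prod>j\<in>{1..n}-{i}. Gamma (\<beta> j + real k * B j))"
      using low_i[of k] d arg[OF i(1), of k] by (intro mult_mono) auto
    also have "\<dots> = (\<Prod>j=1..n. Gamma (\<beta> j + real k * B j))"
      using i by (simp add: prod.remove)
    finally show ?thesis .
  qed
  have bound: "norm (z ^ k / (\<Prod>j=1..n. Gamma (\<beta> j + real k * B j)))
      \<le> (1 / (c * d ^ (n - 1))) * (1 / 2) ^ k" for k
  proof -
    have pos: "0 < c * (2 * z) ^ k * d ^ (n - 1)"
      using c d z by simp
    then have "norm (z ^ k / (\<Prod>j=1..n. Gamma (\<beta> j + real k * B j)))
        = z ^ k / (\<Prod>j=1..n. Gamma (\<beta> j + real k * B j))"
      using low_prod[of k] z by simp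
    also have "\<dots> \<le> z ^ k / (c * (2 * z) ^ k * d ^ (n - 1))"
      using low_prod[of k] pos z by (intro frac_le) auto
    also have "\<dots> = (1 / (c * d ^ (n - 1))) * (1 / 2) ^ k"
      using c d z by (simp add: power_mult_distrib field_simps)
    finally show ?thesis .
  qed
  show ?thesis
    by (rule summable_comparison_test'[where N = 0, OF _ bound])
       (intro summable_mult summable_geometric, simp_all)
qed

text \<open>
  Jensen's inequality for \<open>x \<mapsto> 1 / (x + 1)\<close> at the weighted mean \<open>m\<close>, obtained by summing the
  tangent line inequality at \<open>m\<close>.
\<close>
lemma weighted_mean_inequality:
  fixes w x :: "nat \<Rightarrow> real" and b :: real
  assumes w: "\<And>k. w k \<ge> 0" and x: "\<And>k. x k \<ge> b" and b: "b > 0"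
    and summable_wx: "summable (\<lambda>k. w k * x k)"
  shows "b / (b + 1) * (\<Sum>k. w k)\<^sup>2 \<le> (\<Sum>k. w k * x k) * (\<Sum>k. w k / (x k + 1))"
proof -
  have x0: "x k > 0" for k using x[of k] b by linarith
  have le_wx: "b * w k \<le> w k * x k" for k
    using mult_left_mono[OF x w] by (simp add: mult.commute)
  have "summable (\<lambda>k. b * w k)"
    by (rule summable_comparison_test'[where N = 0, OF summable_wx])
       (use le_wx w b in \<open>simp add: abs_mult\<close>)
  then have summable_w: "summable w"
    using b by simp
  have summable_u: "summable (\<lambda>k. w k / (x k + 1))"
  proof (rule summable_comparison_test'[where N = 0, OF summable_w])
    fix k
    have "w k / (x k + 1) \<le> w k / 1"
      using x0[of k] w[of k] by (intro divide_left_mono) auto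
    then show "norm (w k / (x k + 1)) \<le> w k"
      using x0[of k] w[of k] by simp
  qed
  define S T U where "S = (\<Sum>k. w k * x k)" and "T = (\<Sum>k. w k)"
    and "U = (\<Sum>k. w k / (x k + 1))"
  have T: "T \<ge> 0" using suminf_nonneg[OF summable_w w] by (simp add: T_def)
  have S: "b * T \<le> S"
    unfolding S_def T_def suminf_mult[OF summable_w, symmetric]
    using le_wx summable_w summable_wx by (intro suminf_le summable_mult)
  have "b / (b + 1) * T\<^sup>2 \<le> S * U"
  proof (cases "T = 0")
    case True
    have "S \<ge> 0" using S True by simp
    moreover have "U \<ge> 0"
      unfolding U_def using w x0 by (intro suminf_nonneg summable_u) (simp add: less_imp_le)
    ultimately show ?thesis using True by simp
  next
    case False
    with T have T: "T > 0" by simp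
    define m where "m = S / T"
    have S_eq: "S = m * T" using T by (simp add: m_def)
    have m: "m \<ge> b" using S T by (simp add: S_eq)
    with b have m0: "m > 0" by simp
    have tangent: "2 / (m + 1) * w k - 1 / (m + 1)\<^sup>2 * (w k * x k + w k) \<le> w k / (x k + 1)" for k
    proof -
      have "1 / (x k + 1) - (2 / (m + 1) - 1 / (m + 1)\<^sup>2 * (x k + 1))
          = (x k - m)\<^sup>2 / ((x k + 1) * (m + 1)\<^sup>2)"
        using x0[of k] m0
        by (simp add: divide_simps) (simp add: power2_eq_square algebra_simps)
      also have "\<dots> \<ge> 0" using x0[of k] by simp
      finally have "2 / (m + 1) - 1 / (m + 1)\<^sup>2 * (x k + 1) \<le> 1 / (x k + 1)" by simp
      from mult_left_mono[OF this w[of k]] show ?thesis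
        by (simp add: algebra_simps add_divide_distrib)
    qed
    have "(\<lambda>k. 2 / (m + 1) * w k - 1 / (m + 1)\<^sup>2 * (w k * x k + w k))
        sums (2 / (m + 1) * T - 1 / (m + 1)\<^sup>2 * (S + T))"
      unfolding S_def T_def using summable_w summable_wx
      by (intro sums_diff sums_mult sums_add summable_sums)
    then have "2 / (m + 1) * T - 1 / (m + 1)\<^sup>2 * (S + T) \<le> U"
      unfolding U_def by (rule sums_le[OF tangent _ summable_sums[OF summable_u]])
    moreover have "2 / (m + 1) * T - 1 / (m + 1)\<^sup>2 * (S + T) = T / (m + 1)"
      using m0 unfolding S_eq by (simp add: divide_simps) (simp add: power2_eq_square algebra_simps)
    ultimately have U: "T / (m + 1) \<le> U" by simp
    have "b / (b + 1) \<le> m / (m + 1)"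
      using m b m0 by (simp add: divide_simps algebra_simps)
    then have "b / (b + 1) * T\<^sup>2 \<le> m / (m + 1) * T\<^sup>2"
      by (intro mult_right_mono) auto
    also have "\<dots> = S * (T / (m + 1))"
      by (simp add: S_eq power2_eq_square)
    also have "\<dots> \<le> S * U"
      using U m0 T by (intro mult_left_mono) (auto simp: S_eq)
    finally show ?thesis .
  qed
  then show ?thesis by (simp add: S_def T_def U_def)
qed

theorem corollary2:
  fixes n :: nat and B \<beta> :: "nat \<Rightarrow> real" and z :: real
  assumes "n \<ge> 1"
    and "\<And>j. j \<in> {1..n} \<Longrightarrow> \<beta> j > 0"
    and "\<And>j. j \<in> {1..n} \<Longrightarrow> B j \<ge> 0"
    and "(\<Sum>j=1..n. (B j)\<^sup>2) \<noteq> 0"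
    and "z > 0"
  shows "mittag_leffler n B \<beta> z * mittag_leffler n B (\<beta>(1 := \<beta> 1 + 2)) z
           - \<beta> 1 / (\<beta> 1 + 1) * (mittag_leffler n B (\<beta>(1 := \<beta> 1 + 1)) z)\<^sup>2 \<ge> 0"
proof -
  obtain i where i: "i \<in> {1..n}" "B i \<noteq> 0"
    using assms(4) by (metis (no_types, lifting) sum.neutral zero_power2)
  then have "B i > 0" using assms(3)[of i] by simp
  with assms(2,3,5) i(1)
  have summable_\<beta>: "summable (\<lambda>k. z ^ k / (\<Prod>j=1..n. Gamma (\<beta> j + real k * B j)))"
    by (intro mittag_leffler_summable)
  define P where "P k = (\<Prod>j=2..n. Gamma (\<beta> j + real k * B j))" for k
  define x where "x k = \<beta> 1 + real k * B 1" for k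
  define w where "w k = z ^ k / (Gamma (x k + 1) * P k)" for k
  have \<beta>1: "\<beta> 1 > 0" and B1: "B 1 \<ge> 0" using assms by auto
  have x: "x k \<ge> \<beta> 1" for k using B1 by (simp add: x_def)
  then have x0: "x k > 0" for k using \<beta>1 less_le_trans by blast
  have P: "P k > 0" for k
    unfolding P_def using assms(2,3)
    by (intro prod_pos Gamma_real_pos add_pos_nonneg mult_nonneg_nonneg ballI) auto
  have Gamma_step: "Gamma (t + 1) = t * Gamma t" if "t > 0" for t :: real
    using that by (intro Gamma_plus1) auto
  have split: "(\<Prod>j=1..n. Gamma ((\<beta>(1 := a)) j + real k * B j)) = Gamma (a + real k * B 1) * P k"
    for a k
  proof -
    have "{1..n} = insert 1 {2..n}" using assms(1) by auto
    then show ?thesis by (simp add: P_def)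
  qed
  have term0: "z ^ k / (\<Prod>j=1..n. Gamma (\<beta> j + real k * B j)) = w k * x k" for k
    using split[of "\<beta> 1" k] Gamma_step[OF x0[of k]] x0[of k]
    unfolding fun_upd_triv w_def x_def by simp
  have term1: "z ^ k / (\<Prod>j=1..n. Gamma ((\<beta>(1 := \<beta> 1 + 1)) j + real k * B j)) = w k" for k
    unfolding split w_def x_def by (simp add: algebra_simps)
  have term2: "z ^ k / (\<Prod>j=1..n. Gamma ((\<beta>(1 := \<beta> 1 + 2)) j + real k * B j))
      = w k / (x k + 1)" for k
  proof -
    have "\<beta> 1 + 2 + real k * B 1 = (x k + 1) + 1" by (simp add: x_def)
    then have "Gamma (\<beta> 1 + 2 + real k * B 1) = (x k + 1) * Gamma (x k + 1)"
      using Gamma_step[of "x k + 1"] x0[of k] by (simp only:)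
    then show ?thesis unfolding split by (simp add: w_def)
  qed
  have "w k \<ge> 0" for k
    using P[of k] x0[of k] assms(5) by (simp add: w_def Gamma_real_pos less_imp_le)
  moreover have "summable (\<lambda>k. w k * x k)"
    using summable_\<beta> unfolding term0 by simp
  ultimately have "\<beta> 1 / (\<beta> 1 + 1) * (\<Sum>k. w k)\<^sup>2 \<le> (\<Sum>k. w k * x k) * (\<Sum>k. w k / (x k + 1))"
    using x \<beta>1 by (intro weighted_mean_inequality)
  then show ?thesis
    unfolding mittag_leffler_def of_real_eq_id id_apply term0 term1 term2 by simp
qed

end
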